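(* Let $T\subseteq\mathbb{R}$ be unbounded above and let $\{X_t : t \in T\}$ and $\{Y_t : t \in T\}$ be two independent real-valued stochastic processes. If $X_t \leq_{\mathrm{ast}} Y_t$, as $t \to \infty$, then $X_t \leq_{\mathrm{asp}} Y_t$, as $t \to \infty$.
   Context: For a cdf $F$, $F^{\leftarrow}(u)=\inf\{x\in\mathbb{R}: F(x)\ge u\}$ for $u\in(0,1)$. $F_{X_t}$, $F_{Y_t}$ are the cdfs of $X_t,Y_t$, and $\mu$ is Lebesgue measure. For a real-valued function $\psi$ on $T$, $\lim_{t\to\infty}\psi(t)=a\in\mathbb{R}\cup\{-\infty,\infty\}$ means that $\lim_{n\to\infty}\psi(t_n)=a$ for every sequence $\{t_n\}$ in $T$ with $t_n\to\infty$. Asymptotic usual stochastic order: $X_t \leq_{\mathrm{ast}} Y_t$, as $t\to\infty$, means $\lim_{t\to\infty}\mu(\{u\in(0,1): F_{X_t}^{\leftarrow}(u)>F_{Y_t}^{\leftarrow}(u)\})=0$. Asymptotic stochastic precedence order: $X_t \leq_{\mathrm{asp}} Y_t$, as $t\to\infty$, means $\lim_{t\to\infty} P\{X_t\le Y_t\}\ge 1/2$.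
   Formalization: The limit of P{X_t ≤ Y_t} in the asymptotic precedence order need not exist (X_t = Y_t = 0 for even t, i.i.d. uniform for odd t), so the conclusion is read as: the lower limit of P{X_t ≤ Y_t} along every sequence in T tending to infinity is at least 1/2. *)

theory Defs
  imports "HOL-Probability.Probability"
begin

definition quantile :: "(real \<Rightarrow> real) \<Rightarrow> real \<Rightarrow> real" where
  "quantile F u = Inf {x. F x \<ge> u}"

definition seqs_to_infinity :: "real set \<Rightarrow> (nat \<Rightarrow> real) set" where
  "seqs_to_infinity T = {s. (\<forall>n. s n \<in> T) \<and> filterlim s at_top sequentially}"

definition lim_along :: "real set \<Rightarrow> (real \<Rightarrow> real) \<Rightarrow> ereal \<Rightarrow> bool" where
  "lim_along T \<psi> a \<longleftrightarrow>
     (\<forall>s \<in> seqs_to_infinity T. (\<lambda>n. ereal (\<psi> (s n))) \<longlonglongrightarrow> a)"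

text \<open>The condition \<open>lim \<psi>(t) \<ge> a\<close> does not presuppose that the limit exists:
  along every sequence, all limit points of \<open>\<psi>\<close> are at least \<open>a\<close>. If the limit exists, this
  says precisely that it is at least \<open>a\<close>.\<close>

definition lim_along_ge :: "real set \<Rightarrow> (real \<Rightarrow> real) \<Rightarrow> ereal \<Rightarrow> bool" where
  "lim_along_ge T \<psi> a \<longleftrightarrow>
     (\<forall>s \<in> seqs_to_infinity T. liminf (\<lambda>n. ereal (\<psi> (s n))) \<ge> a)"

context prob_space
begin

definition ast_le :: "real set \<Rightarrow> (real \<Rightarrow> 'a \<Rightarrow> real) \<Rightarrow> (real \<Rightarrow> 'a \<Rightarrow> real) \<Rightarrow> bool" where
  "ast_le T X Y \<longleftrightarrow>
     lim_along T (\<lambda>t. measure lebesgue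
       {u \<in> {0<..<1}. quantile (cdf (distr M borel (X t))) u
                     > quantile (cdf (distr M borel (Y t))) u}) 0"

definition asp_le :: "real set \<Rightarrow> (real \<Rightarrow> 'a \<Rightarrow> real) \<Rightarrow> (real \<Rightarrow> 'a \<Rightarrow> real) \<Rightarrow> bool" where
  "asp_le T X Y \<longleftrightarrow>
     lim_along_ge T (\<lambda>t. prob {\<omega> \<in> space M. X t \<omega> \<le> Y t \<omega>}) (1/2)"

text \<open>Independence of the processes as wholes: the random elements \<open>(X t)\<close> and \<open>(Y t)\<close>
  of the product space over \<open>T\<close> are independent.\<close>

definition indep_processes :: "real set \<Rightarrow> (real \<Rightarrow> 'a \<Rightarrow> real) \<Rightarrow> (real \<Rightarrow> 'a \<Rightarrow> real) \<Rightarrow> bool" where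
  "indep_processes T X Y \<longleftrightarrow>
     indep_var (PiM T (\<lambda>_. borel)) (\<lambda>\<omega>. \<lambda>t\<in>T. X t \<omega>)
               (PiM T (\<lambda>_. borel)) (\<lambda>\<omega>. \<lambda>t\<in>T. Y t \<omega>)"

end

end

theory Submission
  imports Defs
begin

text \<open>
  The statement follows from a quantitative bound at a fixed time. For independent random
  variables \<open>X\<close> and \<open>Y\<close> with quantile functions \<open>p\<close> and \<open>q\<close>, it says
  \<open>P(X \<le> Y) \<ge> 1/2 - \<mu>{u. p u > q u}\<close>
  (\<open>precedence_ge_half_minus_quantile_excess\<close>).

  To see this, let \<open>U\<close> and \<open>V\<close> be independent and uniform on \<open>(0,1)\<close>. The quantile transform
  realises the joint law of \<open>(X, Y)\<close> as that of \<open>(p U, q V)\<close>; this is where independence of \<open>X\<close>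
  and \<open>Y\<close> enters. If \<open>U \<le> V\<close> and \<open>V\<close> avoids the exceptional set, then
  \<open>p U \<le> p V \<le> q V\<close> because \<open>p\<close> is monotone. The event \<open>U \<le> V\<close> has probability at least
  \<open>1/2\<close> by exchangeability (\<open>total_relation_prob_ge_half\<close>), and the exceptional set costs at most
  its measure.

  Under the asymptotic usual stochastic order the exceptional measure tends to \<open>0\<close> along every
  sequence in \<open>T\<close> tending to infinity, so the lower limit of the probabilities is at least \<open>1/2\<close>.
\<close>

abbreviation unit_uniform :: "real measure" where
  "unit_uniform \<equiv> restrict_space lborel {0<..<1}"

lemma prob_space_unit_uniform: "prob_space unit_uniform"
  by (auto simp: emeasure_restrict_space space_restrict_space intro!: prob_spaceI)

text \<open>
  Swapping the coordinates preserves the product measure, so the relation and its converse are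
  equally likely; by totality, one of them always holds.
\<close>
lemma total_relation_prob_ge_half:
  assumes "prob_space N"
    and R: "{z \<in> space (N \<Otimes>\<^sub>M N). R (fst z) (snd z)} \<in> sets (N \<Otimes>\<^sub>M N)"
    and total: "\<And>x y. x \<in> space N \<Longrightarrow> y \<in> space N \<Longrightarrow> R x y \<or> R y x"
  shows "measure (N \<Otimes>\<^sub>M N) {z \<in> space (N \<Otimes>\<^sub>M N). R (fst z) (snd z)} \<ge> 1/2"
proof -
  interpret N: prob_space N by fact
  interpret S: pair_prob_space N N ..
  let ?P = "N \<Otimes>\<^sub>M N"
  let ?A = "{z \<in> space ?P. R (fst z) (snd z)}"
  let ?B = "{z \<in> space ?P. R (snd z) (fst z)}"
  have B: "(\<lambda>(x, y). (y, x)) -` ?A \<inter> space ?P = ?B"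
    by (auto simp: space_pair_measure)
  have swap: "(\<lambda>(x, y). (y, x)) \<in> ?P \<rightarrow>\<^sub>M ?P"
    by (rule measurable_pair_swap')
  have Bs: "?B \<in> sets ?P"
    using measurable_sets[OF swap R] unfolding B .
  have "measure ?P ?A = measure (distr ?P ?P (\<lambda>(x, y). (y, x))) ?A"
    using S.distr_pair_swap by simp
  also have "\<dots> = measure ?P ?B"
    unfolding measure_distr[OF swap R] B ..
  finally have eq: "measure ?P ?A = measure ?P ?B" .
  have "R (fst z) (snd z) \<or> R (snd z) (fst z)" if "z \<in> space ?P" for z
    using that total[of "fst z" "snd z"] by (auto simp: space_pair_measure)
  then have "?A \<union> ?B = space ?P"
    by blast
  then have "1 = measure ?P (?A \<union> ?B)"
    using S.P.prob_space by simp
  also have "\<dots> \<le> measure ?P ?A + measure ?P ?B"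
    by (rule measure_Un_le[OF R Bs])
  finally show ?thesis
    using eq by simp
qed

lemma sets_pair_borel_le: "{z. fst z \<le> snd z} \<in> sets (borel \<Otimes>\<^sub>M (borel :: real measure))"
proof -
  have "{z \<in> space (borel \<Otimes>\<^sub>M borel). fst z \<le> snd z} \<in> sets (borel \<Otimes>\<^sub>M (borel :: real measure))"
    by measurable
  then show ?thesis
    by (simp add: space_pair_measure)
qed

lemma quantile_cdf_mono:
  assumes "real_distribution P" "0 < u" "u \<le> v" "v < 1"
  shows "quantile (cdf P) u \<le> quantile (cdf P) v"
proof -
  interpret cdf_distribution P
    unfolding cdf_distribution_def by fact
  show ?thesis
    using mono_onD[OF mono_I, of u v] assms by (simp add: quantile_def)
qed

lemma measurable_quantile_cdf:
  assumes "real_distribution P"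
  shows "quantile (cdf P) \<in> borel_measurable unit_uniform"
proof -
  interpret cdf_distribution P
    unfolding cdf_distribution_def by fact
  have "sets unit_uniform = sets (restrict_space borel {0<..<1})"
    by (simp add: sets_restrict_space)
  then show ?thesis
    using measurable_CI by (simp add: quantile_def[abs_def] cong: measurable_cong_sets)
qed

lemma distr_quantile_cdf:
  assumes "real_distribution P"
  shows "distr unit_uniform borel (quantile (cdf P)) = P"
proof -
  interpret cdf_distribution P
    unfolding cdf_distribution_def by fact
  show ?thesis
    using distr_I_eq_M by (simp add: quantile_def[abs_def])
qed

text \<open>
  The quantile coupling: under independent uniform levels \<open>u\<close> and \<open>v\<close>, the ordering can fail
  only if \<open>u > v\<close> or \<open>v\<close> is a level at which the quantile of \<open>P\<close> exceeds that of \<open>Q\<close>.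
\<close>
lemma product_precedence_ge_half_minus_quantile_excess:
  assumes P: "real_distribution P" and Q: "real_distribution Q"
  shows "measure (P \<Otimes>\<^sub>M Q) {z. fst z \<le> snd z} \<ge>
    1/2 - measure lebesgue {u \<in> {0<..<1}. quantile (cdf P) u > quantile (cdf Q) u}"
proof -
  let ?N = "unit_uniform"
  define p where "p = quantile (cdf P)"
  define q where "q = quantile (cdf Q)"
  interpret N: prob_space ?N by (rule prob_space_unit_uniform)
  interpret NN: pair_prob_space ?N ?N ..
  interpret Q: real_distribution Q by fact
  have p[measurable]: "p \<in> borel_measurable ?N" and q[measurable]: "q \<in> borel_measurable ?N"
    unfolding p_def q_def by (simp_all add: measurable_quantile_cdf P Q)
  have id[measurable]: "(\<lambda>x. x) \<in> borel_measurable ?N"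
    by (rule measurable_restrict_space1) simp
  define E where "E = {u \<in> space ?N. p u > q u}"
  have E[measurable]: "E \<in> sets ?N"
    unfolding E_def by measurable
  have "sigma_finite_measure (distr ?N borel q)"
    unfolding q_def distr_quantile_cdf[OF Q] by unfold_locales
  then have PQ: "P \<Otimes>\<^sub>M Q = distr (?N \<Otimes>\<^sub>M ?N) (borel \<Otimes>\<^sub>M borel) (\<lambda>(u, v). (p u, q v))"
    using pair_measure_distr[OF p q] by (simp add: p_def q_def distr_quantile_cdf P Q)
  let ?D = "{z \<in> space (?N \<Otimes>\<^sub>M ?N). fst z \<le> snd z}"
  let ?C = "{z \<in> space (?N \<Otimes>\<^sub>M ?N). p (fst z) \<le> q (snd z)}"
  have D: "?D \<in> sets (?N \<Otimes>\<^sub>M ?N)"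
    by measurable
  have C: "?C \<in> sets (?N \<Otimes>\<^sub>M ?N)"
    by measurable
  have SE: "space ?N \<times> E \<in> sets (?N \<Otimes>\<^sub>M ?N)"
    by (rule pair_measureI[OF sets.top E])
  have "z \<in> ?C \<union> space ?N \<times> E" if "z \<in> ?D" for z
  proof (cases "snd z \<in> E")
    case False
    have "p (fst z) \<le> p (snd z)"
      using that quantile_cdf_mono[OF P, of "fst z" "snd z"]
      by (auto simp: p_def space_pair_measure space_restrict_space)
    also have "p (snd z) \<le> q (snd z)"
      using that False by (auto simp: E_def space_pair_measure)
    finally show ?thesis
      using that by simp
  qed (use that in \<open>auto simp: space_pair_measure\<close>)
  then have "?D \<subseteq> ?C \<union> space ?N \<times> E"
    by blast
  then have "measure (?N \<Otimes>\<^sub>M ?N) ?D \<le> measure (?N \<Otimes>\<^sub>M ?N) (?C \<union> space ?N \<times> E)"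
    by (rule NN.P.finite_measure_mono) (use C SE in blast)
  also have "\<dots> \<le> measure (?N \<Otimes>\<^sub>M ?N) ?C + measure (?N \<Otimes>\<^sub>M ?N) (space ?N \<times> E)"
    by (rule measure_Un_le[OF C SE])
  also have "measure (?N \<Otimes>\<^sub>M ?N) (space ?N \<times> E) = measure ?N E"
    unfolding measure_def N.emeasure_pair_measure_Times[OF sets.top E] N.emeasure_space_1
    by simp
  also have "measure ?N E = measure lebesgue {u \<in> {0<..<1}. p u > q u}"
  proof -
    have E_eq: "E = {u \<in> {0<..<1}. p u > q u}"
      by (simp add: E_def space_restrict_space)
    have "E \<in> sets lborel"
      using E by (auto simp: sets_restrict_space_iff)
    moreover have "measure ?N E = measure lborel E"
      by (rule measure_restrict_space) (auto simp: E_eq)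
    ultimately show ?thesis
      by (simp add: E_eq)
  qed
  also have "measure (?N \<Otimes>\<^sub>M ?N) ?C = measure (P \<Otimes>\<^sub>M Q) {z. fst z \<le> snd z}"
  proof -
    have "(\<lambda>(u, v). (p u, q v)) \<in> ?N \<Otimes>\<^sub>M ?N \<rightarrow>\<^sub>M borel \<Otimes>\<^sub>M borel"
      by measurable
    moreover have "(\<lambda>(u, v). (p u, q v)) -` {z. fst z \<le> snd z} \<inter> space (?N \<Otimes>\<^sub>M ?N) = ?C"
      by auto
    ultimately show ?thesis
      unfolding PQ by (simp only: measure_distr sets_pair_borel_le)
  qed
  finally show ?thesis
    using total_relation_prob_ge_half[OF N.prob_space_axioms D] by (simp add: p_def q_def linear)
qed

lemma (in prob_space) precedence_ge_half_minus_quantile_excess: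
  assumes "indep_var borel X borel (Y :: 'a \<Rightarrow> real)"
  shows "prob {\<omega> \<in> space M. X \<omega> \<le> Y \<omega>} \<ge>
    1/2 - measure lebesgue {u \<in> {0<..<1}.
      quantile (cdf (distr M borel X)) u > quantile (cdf (distr M borel Y)) u}"
proof -
  have X[measurable]: "X \<in> borel_measurable M" and Y[measurable]: "Y \<in> borel_measurable M"
    and joint: "distr M borel X \<Otimes>\<^sub>M distr M borel Y = distr M (borel \<Otimes>\<^sub>M borel) (\<lambda>\<omega>. (X \<omega>, Y \<omega>))"
    using assms unfolding indep_var_distribution_eq by auto
  have "measure (distr M borel X \<Otimes>\<^sub>M distr M borel Y) {z. fst z \<le> snd z}
      = prob {\<omega> \<in> space M. X \<omega> \<le> Y \<omega>}"
  proof -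
    have "(\<lambda>\<omega>. (X \<omega>, Y \<omega>)) \<in> M \<rightarrow>\<^sub>M borel \<Otimes>\<^sub>M borel"
      by measurable
    moreover have "(\<lambda>\<omega>. (X \<omega>, Y \<omega>)) -` {z. fst z \<le> snd z} \<inter> space M
        = {\<omega> \<in> space M. X \<omega> \<le> Y \<omega>}"
      by auto
    ultimately show ?thesis
      unfolding joint by (simp only: measure_distr sets_pair_borel_le)
  qed
  then show ?thesis
    using product_precedence_ge_half_minus_quantile_excess[of "distr M borel X" "distr M borel Y"]
    by (simp add: real_distribution_distr)
qed

lemma (in prob_space) indep_processes_marginals:
  assumes "indep_processes T X Y" "t \<in> T"
  shows "indep_var borel (X t) borel (Y t)"
proof -
  have "(\<lambda>f. f t) \<in> borel_measurable (Pi\<^sub>M T (\<lambda>_. borel :: real measure))"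
    using assms(2) by (rule measurable_component_singleton)
  from indep_var_compose[OF assms(1)[unfolded indep_processes_def] this this]
  show ?thesis
    using assms(2) by (simp add: comp_def)
qed

theorem theorem3p3:
  fixes M :: "'a measure" and T :: "real set" and X Y :: "real \<Rightarrow> 'a \<Rightarrow> real"
  assumes "prob_space M"
    and "\<not> bdd_above T"
    and "\<And>t. t \<in> T \<Longrightarrow> X t \<in> borel_measurable M"
    and "\<And>t. t \<in> T \<Longrightarrow> Y t \<in> borel_measurable M"
    and "prob_space.indep_processes M T X Y"
    and "prob_space.ast_le M T X Y"
  shows "prob_space.asp_le M T X Y"
proof -
  interpret prob_space M by fact
  define excess where "excess t = measure lebesgue {u \<in> {0<..<1}.
    quantile (cdf (distr M borel (X t))) u > quantile (cdf (distr M borel (Y t))) u}" for t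
  show ?thesis
    unfolding asp_le_def lim_along_ge_def
  proof
    fix s assume s: "s \<in> seqs_to_infinity T"
    have bound: "1/2 - excess (s n) \<le> prob {\<omega> \<in> space M. X (s n) \<omega> \<le> Y (s n) \<omega>}" for n
      using s precedence_ge_half_minus_quantile_excess[OF indep_processes_marginals[OF assms(5)]]
      by (simp add: seqs_to_infinity_def excess_def)
    have "(\<lambda>n. ereal (excess (s n))) \<longlonglongrightarrow> 0"
      using assms(6) s unfolding ast_le_def lim_along_def excess_def by blast
    then have "(\<lambda>n. excess (s n)) \<longlonglongrightarrow> 0"
      by (simp add: zero_ereal_def)
    then have "(\<lambda>n. 1/2 - excess (s n)) \<longlonglongrightarrow> 1/2 - 0"
      by (intro tendsto_intros)
    then have lim: "(\<lambda>n. ereal (1/2 - excess (s n))) \<longlonglongrightarrow> ereal (1/2)"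
      by simp
    have "1/2 = ereal (1/2)"
      by (simp add: one_ereal_def)
    also have "\<dots> = liminf (\<lambda>n. ereal (1/2 - excess (s n)))"
      by (rule lim_imp_Liminf[OF sequentially_bot lim, symmetric])
    also have "\<dots> \<le> liminf (\<lambda>n. ereal (prob {\<omega> \<in> space M. X (s n) \<omega> \<le> Y (s n) \<omega>}))"
      using bound by (intro Liminf_mono always_eventually) simp
    finally show "1/2 \<le> liminf (\<lambda>n. ereal (prob {\<omega> \<in> space M. X (s n) \<omega> \<le> Y (s n) \<omega>}))" .
  qed
qed

end
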